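(* Let $X$ be a Hilbert space, let $\mathbf{\Omega}=\{\Omega_1,\Omega_2\}$ be a collection of two subsets of $X$, and let $\bar x\in\Omega_1\cap\Omega_2$. Then $$\hat\eta[\mathbf{\Omega}](\bar x)=\lim_{\delta\downarrow0}\inf\left\{\|x_1^*+x_2^*\|\ \middle|\ x_i^*\in\widehat N_{\Omega_i}(\bar x,\delta),\ \|x_i^*\|=\tfrac12\ (i=1,2)\right\},$$ where it is assumed that the infimum over the empty set equals $1$.
   Context: $X^*$ is identified with the Hilbert space $X$; $B_\delta(x)$ is the closed ball with center $x$ and radius $\delta$. For $\Omega\subset X$ and $x\in\Omega$, the Fréchet normal cone is $N_\Omega(x)=\{x^*\in X\mid\limsup_{y\to x,\,y\in\Omega}\frac{\langle x^*,y-x\rangle}{\|y-x\|}\le0\}$ (equal to $X$ if $x$ is isolated in $\Omega$). For $\bar x\in\Omega$ and $\delta\ge0$, $\widehat N_\Omega(\bar x,\delta)=\bigcup_{x\in\Omega\cap B_\delta(\bar x)}N_\Omega(x)$. The constant $\hat\eta$ is defined by $$\hat\eta[\mathbf{\Omega}](\bar x)=\lim_{\delta\downarrow0}\inf\{\|x_1^*+x_2^*\|\mid x_i^*\in\widehat N_{\Omega_i}(\bar x,\delta)\ (i=1,2),\ \|x_1^*\|+\|x_2^*\|=1\},$$ where the infimum over the empty set equals $1$. *)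

theory Defs
  imports "HOL-Analysis.Analysis"
begin

text \<open>If \<open>x\<close> is isolated in \<open>\<Omega>\<close>, the filter \<open>at x within \<Omega>\<close> is trivial, the upper limit is
  \<open>-\<infinity>\<close>, and the cone is the whole space.\<close>

definition frechet_normal_cone :: "'a::real_inner set \<Rightarrow> 'a \<Rightarrow> 'a set" where
  "frechet_normal_cone \<Omega> x =
     {x'. Limsup (at x within \<Omega>) (\<lambda>y. ereal (inner x' (y - x) / norm (y - x))) \<le> 0}"

definition near_normals :: "'a::real_inner set \<Rightarrow> 'a \<Rightarrow> real \<Rightarrow> 'a set" where
  "near_normals \<Omega> xbar \<delta> = (\<Union>x\<in>\<Omega> \<inter> cball xbar \<delta>. frechet_normal_cone \<Omega> x)"

text \<open>Infimum of a set of reals, with the convention that it is 1 for the empty set.\<close>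

definition inf_or_one :: "real set \<Rightarrow> real" where
  "inf_or_one S = (if S = {} then 1 else Inf S)"

definition hat_eta :: "'a::real_inner set \<Rightarrow> 'a set \<Rightarrow> 'a \<Rightarrow> real" where
  "hat_eta \<Omega>1 \<Omega>2 xbar = Lim (at_right 0) (\<lambda>\<delta>. inf_or_one
     {norm (x1 + x2) | x1 x2. x1 \<in> near_normals \<Omega>1 xbar \<delta> \<and> x2 \<in> near_normals \<Omega>2 xbar \<delta> \<and>
        norm x1 + norm x2 = 1})"

text \<open>The limit defining \<open>hat_eta\<close> always exists, so \<open>Lim\<close> is never applied to a divergent
  expression.\<close>

lemma near_normals_mono: "\<delta> \<le> \<epsilon> \<Longrightarrow> near_normals \<Omega> xbar \<delta> \<subseteq> near_normals \<Omega> xbar \<epsilon>"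
  by (force simp: near_normals_def)

lemma tendsto_hat_eta:
  fixes \<Omega>1 \<Omega>2 :: "'a::real_inner set"
  shows "((\<lambda>\<delta>. inf_or_one
     {norm (x1 + x2) | x1 x2. x1 \<in> near_normals \<Omega>1 xbar \<delta> \<and> x2 \<in> near_normals \<Omega>2 xbar \<delta> \<and>
        norm x1 + norm x2 = 1}) \<longlongrightarrow> hat_eta \<Omega>1 \<Omega>2 xbar) (at_right 0)"
proof -
  define S where "S \<delta> = {norm (x1 + x2) | x1 x2. x1 \<in> near_normals \<Omega>1 xbar \<delta> \<and>
      x2 \<in> near_normals \<Omega>2 xbar \<delta> \<and> norm x1 + norm x2 = 1}" for \<delta>
  define f where "f \<delta> = inf_or_one (S \<delta>)" for \<delta>
  have S01: "0 \<le> s \<and> s \<le> 1" if "s \<in> S \<delta>" for s \<delta>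
  proof -
    from that obtain x1 x2 :: 'a where "s = norm (x1 + x2)" "norm x1 + norm x2 = 1"
      unfolding S_def by blast
    then show ?thesis
      using norm_triangle_ineq[of x1 x2] by simp
  qed
  have bdd: "bdd_below (S \<delta>)" for \<delta>
    using S01 by (meson bdd_belowI)
  have le1: "f \<delta> \<le> 1" for \<delta>
  proof (cases "S \<delta> = {}")
    case False
    then obtain s where s: "s \<in> S \<delta>" by blast
    show ?thesis
      using cInf_lower[OF s bdd] S01[OF s] False by (simp add: f_def inf_or_one_def)
  qed (simp add: f_def inf_or_one_def)
  have anti: "f \<epsilon> \<le> f \<delta>" if "\<delta> \<le> \<epsilon>" for \<delta> \<epsilon>
  proof (cases "S \<delta> = {}")
    case True
    then show ?thesis using le1[of \<epsilon>] by (simp add: f_def inf_or_one_def)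
  next
    case False
    have sub: "S \<delta> \<subseteq> S \<epsilon>"
      unfolding S_def using near_normals_mono[OF that] by blast
    show ?thesis
      using False sub cInf_superset_mono[OF False bdd sub] by (auto simp: f_def inf_or_one_def)
  qed
  define L where "L = (SUP \<delta>\<in>{0<..}. f \<delta>)"
  have bda: "bdd_above (f ` {0<..})"
    using le1 by (intro bdd_aboveI2)
  have "(f \<longlongrightarrow> L) (at_right 0)"
  proof (rule order_tendstoI)
    fix a assume "a < L"
    then obtain d where d: "d > 0" "a < f d"
      unfolding L_def using less_cSUP_iff[OF _ bda] by auto
    show "\<forall>\<^sub>F \<delta> in at_right 0. a < f \<delta>"
      unfolding eventually_at_right_field
      using d anti by (meson less_imp_le less_le_trans)
  next
    fix a assume "L < a"
    moreover have "f \<delta> \<le> L" if "\<delta> > 0" for \<delta>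
      unfolding L_def using that by (intro cSUP_upper[OF _ bda]) auto
    ultimately show "\<forall>\<^sub>F \<delta> in at_right 0. f \<delta> < a"
      unfolding eventually_at_right_field by (meson le_less_trans zero_less_one)
  qed
  moreover from this have "Lim (at_right 0) f = L"
    by (intro tendsto_Lim) auto
  ultimately show ?thesis
    unfolding hat_eta_def f_def[abs_def] S_def by simp
qed

end

theory Submission
  imports Defs
begin

text \<open>Normalising a pair of nonzero normals with \<open>\<parallel>x\<^sub>1\<parallel> + \<parallel>x\<^sub>2\<parallel> = 1\<close> to norm \<open>1/2\<close> each cannot increase the
  norm of the sum: if \<open>c\<close> is the cosine of their angle, then
  \<open>\<parallel>x\<^sub>1 + x\<^sub>2\<parallel>\<^sup>2 = 1 - 2 \<parallel>x\<^sub>1\<parallel> \<parallel>x\<^sub>2\<parallel> (1 - c)\<close>, which is smallest when \<open>\<parallel>x\<^sub>1\<parallel> = \<parallel>x\<^sub>2\<parallel> = 1/2\<close>. Pairs with a zero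
  component give the value 1 and do not matter. As the normal cones are invariant under scaling, the
  two infima agree for every \<open>\<delta>\<close>, not only in the limit.\<close>

lemma frechet_normal_cone_scaleR:
  assumes "x' \<in> frechet_normal_cone \<Omega> x" "c > 0"
  shows "c *\<^sub>R x' \<in> frechet_normal_cone \<Omega> x"
proof -
  define q where "q y = inner x' (y - x) / norm (y - x)" for y
  have "\<forall>\<^sub>F y in at x within \<Omega>. ereal (c * q y) < b" if "b > 0" for b
  proof (cases b)
    case (real r)
    \<comment> \<open>The factor \<open>c\<close> moves into the bound: \<open>c * q y < r\<close>
      means \<open>q y < r / c\<close>, and the hypothesis applies to every positive bound. An
      infinite \<open>b\<close> is trivial.\<close>
    then have "ereal (r / c) > 0"
      using that assms(2) by simp
    then have "\<forall>\<^sub>F y in at x within \<Omega>. ereal (q y) < ereal (r / c)"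
      using assms(1) unfolding frechet_normal_cone_def q_def Limsup_le_iff by blast
    then show ?thesis
      by eventually_elim (use assms(2) real in \<open>simp add: field_simps\<close>)
  qed (use that in auto)
  then show ?thesis
    unfolding frechet_normal_cone_def Limsup_le_iff q_def by simp
qed

lemma near_normals_scaleR:
  "x' \<in> near_normals \<Omega> xbar \<delta> \<Longrightarrow> c > 0 \<Longrightarrow> c *\<^sub>R x' \<in> near_normals \<Omega> xbar \<delta>"
  unfolding near_normals_def using frechet_normal_cone_scaleR by blast

lemma norm_normalized_sum_le:
  fixes x y :: "'a::real_inner"
  assumes "x \<noteq> 0" "y \<noteq> 0" "norm x + norm y = 1"
  shows "norm ((1 / (2 * norm x)) *\<^sub>R x + (1 / (2 * norm y)) *\<^sub>R y) \<le> norm (x + y)"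
proof (rule power2_le_imp_le)
  define a b c where "a = norm x" "b = norm y" and "c = inner x y / (a * b)"
  have ab: "a > 0" "b > 0" "a + b = 1"
    using assms by (simp_all add: a_b_def(1) a_b_def(2))
  have xy: "inner x y = a * b * c"
    using ab by (simp add: c_def)
  have "inner x y \<le> a * b"
    unfolding a_b_def by (rule norm_cauchy_schwarz)
  then have "c \<le> 1"
    using ab by (simp add: c_def)
  \<comment> \<open>AM-GM under \<open>a + b = 1\<close>; since \<open>1 - c\<close> is nonnegative
    by Cauchy-Schwarz, it may then be multiplied in.\<close>
  have "4 * (a * b) = 1 - (a - b)\<^sup>2"
    using ab(3) by algebra
  then have "a * b \<le> 1 / 4"
    using zero_le_power2[of "a - b"] by linarith
  then have abc: "a * b * (1 - c) \<le> 1 / 4 * (1 - c)"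
    using \<open>c \<le> 1\<close> by (intro mult_right_mono) auto
  have sq: "(norm (p *\<^sub>R x + q *\<^sub>R y))\<^sup>2
      = p\<^sup>2 * (norm x)\<^sup>2 + q\<^sup>2 * (norm y)\<^sup>2 + 2 * (p * q) * inner x y" for p q
    unfolding power2_norm_eq_inner
    by (simp add: inner_add_left inner_add_right inner_commute power2_eq_square)
  have norm_xy: "(norm (x + y))\<^sup>2 = a\<^sup>2 + b\<^sup>2 + 2 * inner x y"
    using sq[of 1 1] by (simp add: a_b_def)
  have ab2: "a\<^sup>2 + b\<^sup>2 = 1 - 2 * (a * b)"
    using ab(3) by algebra
  have "(norm ((1 / (2 * a)) *\<^sub>R x + (1 / (2 * b)) *\<^sub>R y))\<^sup>2
      = (1 / (2 * a))\<^sup>2 * a\<^sup>2 + (1 / (2 * b))\<^sup>2 * b\<^sup>2 + 2 * (1 / (2 * a) * (1 / (2 * b))) * inner x y"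
    unfolding sq a_b_def by simp
  \<comment> \<open>This is \<open>1 - 2 * (a * b) * (1 - c)\<close> with \<open>a * b\<close>
    replaced by its maximum \<open>1 / 4\<close>.\<close>
  also have "\<dots> = (1 + c) / 2"
    using ab by (simp add: xy power2_eq_square field_simps)
  also have "\<dots> \<le> (norm (x + y))\<^sup>2"
    using abc unfolding norm_xy ab2 xy by (simp add: field_simps)
  finally show "(norm ((1 / (2 * norm x)) *\<^sub>R x + (1 / (2 * norm y)) *\<^sub>R y))\<^sup>2 \<le> (norm (x + y))\<^sup>2"
    unfolding a_b_def .
qed simp

lemma inf_or_one_lower: "s \<in> S \<Longrightarrow> bdd_below S \<Longrightarrow> inf_or_one S \<le> s"
  by (auto simp: inf_or_one_def intro: cInf_lower)

text \<open>The premise \<open>z \<le> 1\<close> covers the default value of the empty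
  infimum.\<close>

lemma inf_or_one_greatest: "(\<And>s. s \<in> S \<Longrightarrow> z \<le> s) \<Longrightarrow> z \<le> 1 \<Longrightarrow> z \<le> inf_or_one S"
  by (auto simp: inf_or_one_def intro: cInf_greatest)

lemma inf_or_one_le_1:
  assumes "\<And>s. s \<in> S \<Longrightarrow> s \<le> 1" "bdd_below S"
  shows "inf_or_one S \<le> 1"
proof (cases "S = {}")
  case False
  then show ?thesis
    using assms inf_or_one_lower by (meson ex_in_conv order_trans)
qed (simp add: inf_or_one_def)

lemma inf_or_one_normalized_pairs:
  fixes A B :: "'a::real_inner set"
  assumes A: "\<And>x c. x \<in> A \<Longrightarrow> c > 0 \<Longrightarrow> c *\<^sub>R x \<in> A"
    and B: "\<And>x c. x \<in> B \<Longrightarrow> c > 0 \<Longrightarrow> c *\<^sub>R x \<in> B"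
  shows "inf_or_one {norm (x + y) | x y. x \<in> A \<and> y \<in> B \<and> norm x = 1/2 \<and> norm y = 1/2}
    = inf_or_one {norm (x + y) | x y. x \<in> A \<and> y \<in> B \<and> norm x + norm y = 1}"
    (is "inf_or_one ?T = inf_or_one ?S")
proof (rule antisym)
  have sub: "?T \<subseteq> ?S"
    by fastforce
  have bS: "bdd_below ?S"
    by (rule bdd_belowI[of _ 0]) auto
  then have bT: "bdd_below ?T"
    using sub by (rule bdd_below_mono)
  have S1: "s \<le> 1" if "s \<in> ?S" for s
    using that by (auto intro: order_trans[OF norm_triangle_ineq])
  then have T1: "inf_or_one ?T \<le> 1"
    using sub bT by (blast intro: inf_or_one_le_1)
  \<comment> \<open>Passing to a subset raises the infimum; if \<open>?T\<close> is empty, its value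
    1 still dominates, because no element of \<open>?S\<close> exceeds 1.\<close>
  show "inf_or_one ?S \<le> inf_or_one ?T"
    using sub bS S1 by (meson inf_or_one_greatest inf_or_one_lower inf_or_one_le_1 subsetD)
  show "inf_or_one ?T \<le> inf_or_one ?S"
  proof (rule inf_or_one_greatest[OF _ T1])
    fix s assume "s \<in> ?S"
    then obtain x y where s: "s = norm (x + y)" "x \<in> A" "y \<in> B" "norm x + norm y = 1"
      by blast
    show "inf_or_one ?T \<le> s"
    proof (cases "x = 0 \<or> y = 0")
      case True
      \<comment> \<open>Here \<open>s = 1\<close>, so \<open>T1\<close> suffices, even when
        \<open>?T\<close> is empty.\<close>
      then show ?thesis
        using s T1 by auto
    next
      case False
      let ?u = "(1 / (2 * norm x)) *\<^sub>R x" and ?v = "(1 / (2 * norm y)) *\<^sub>R y"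
      have "?u \<in> A" "?v \<in> B"
        using False s by (auto intro!: A B)
      moreover have "norm ?u = 1/2" "norm ?v = 1/2"
        using False by auto
      ultimately have "norm (?u + ?v) \<in> ?T"
        by blast
      then have "inf_or_one ?T \<le> norm (?u + ?v)"
        using bT by (rule inf_or_one_lower)
      also have "\<dots> \<le> s"
        using norm_normalized_sum_le[of x y] False s by simp
      finally show ?thesis .
    qed
  qed
qed

theorem proposition5:
  fixes \<Omega>1 \<Omega>2 :: "'a::{real_inner, complete_space} set" and xbar :: 'a
  assumes "xbar \<in> \<Omega>1 \<inter> \<Omega>2"
  shows "((\<lambda>\<delta>. inf_or_one
    {norm (x1 + x2) | x1 x2. x1 \<in> near_normals \<Omega>1 xbar \<delta> \<and> x2 \<in> near_normals \<Omega>2 xbar \<delta> \<and>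
       norm x1 = 1/2 \<and> norm x2 = 1/2}) \<longlongrightarrow> hat_eta \<Omega>1 \<Omega>2 xbar) (at_right 0)"
  \<comment> \<open>Rewriting the infimum for each \<open>\<delta>\<close> turns the function into
    the one whose limit is \<open>hat_eta\<close>.\<close>
  by (subst inf_or_one_normalized_pairs) (blast intro: near_normals_scaleR tendsto_hat_eta)+

end
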